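(* Let $m$ be a positive integer and let $n_1,\ldots,n_{m}$ be positive integers; set $n_{m+1}=n_1$. Then for any non-negative integers $a$, $j$ and $r$ with $a\leqslant n_1$ and $j\leqslant m$, the expression $$ \frac{1}{[n_1+n_m+1]}{n_1+n_{m}\brack n_1-a}^{-1}\sum_{k=a}^{n_1} q^{j(k^2+k)-(2r+1)k}[2k+1]^{2r+1}\prod_{i=1}^m {n_i+n_{i+1}+1\brack n_i-k} $$ is a Laurent polynomial in $q$ with integer coefficients.
   Context: $q$ is an indeterminate, $[n]=\frac{1-q^n}{1-q}$, $(q;q)_n=(1-q)\cdots(1-q^n)$ with $(q;q)_0=1$, and ${n\brack k}=\frac{(q;q)_n}{(q;q)_k(q;q)_{n-k}}$ for $0\leqslant k\leqslant n$, $0$ otherwise. *)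

theory Defs
  imports "HOL-Computational_Algebra.Polynomial_Factorial"
begin

text \<open>
  All expressions live in the field \<open>int poly fract\<close> of fractions of \<open>\<int>[q]\<close>, that is, in
  the field of rational functions in the indeterminate \<open>q\<close> over the rationals.
\<close>

definition q :: "int poly fract" where
  "q = to_fract (monom 1 1)"

definition q_number :: "nat \<Rightarrow> int poly fract" where
  "q_number n = (1 - q ^ n) / (1 - q)"

text \<open>The \<open>q\<close>-shifted factorial \<open>(q;q)\<^sub>n\<close>.\<close>

definition q_poch :: "nat \<Rightarrow> int poly fract" where
  "q_poch n = (\<Prod>i=1..n. 1 - q ^ i)"

text \<open>
  The lower argument is an integer, so that \<open>n - k\<close> with \<open>n < k\<close> yields the value 0
  instead of being truncated to \<open>0\<close>.
\<close>

definition q_binomial :: "nat \<Rightarrow> int \<Rightarrow> int poly fract" where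
  "q_binomial n k =
    (if 0 \<le> k \<and> k \<le> int n
     then q_poch n / (q_poch (nat k) * q_poch (n - nat k)) else 0)"

definition int_laurent_poly :: "int poly fract \<Rightarrow> bool" where
  "int_laurent_poly f \<longleftrightarrow>
    (\<exists>(A :: int set) (c :: int \<Rightarrow> int). finite A \<and> f = (\<Sum>i\<in>A. of_int (c i) * q powi i))"

end

(*
  Write (n)! for (q;q)_n and w_n(k) = 1 / ((n-k)! (n+k+1)!). Because n_{m+1} = n_1, the product of
  the q-binomial coefficients is the product of the (n_i+n_{i+1}+1)! times the product of the
  w_{n_i}(k). The prefactor cancels the closing factorial (n_m+n_1+1)!, so the cyclic sum becomes a
  sum over the open chain n_1, ..., n_m.

  The q-Vandermonde convolution writes (x+y+1)! w_x(k) w_y(k) as a combination of the w_s(k) with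
  k <= s <= x, y. Applied to n_1 and n_2, it expresses a chain of length m as a combination of chains
  of length m-1, in which the ratios of factorials are q-binomial coefficients. Its two forms either
  leave q^(j(k^2+k)) alone or lower j by one, which is why j <= m suffices.

  For m = 1 and r = 0 the sums with j = 0, 1 telescope. For larger r, put V_k = q^(-k) [k] [k+1].
  Then (q^(-k) [2k+1])^2 = 1 + 2(1+q) V_k + (1-q)^2 V_k^2, and V_n - V_k = q^(-n) [n-k] [n+k+1] turns
  a factor V_k into a combination of the sums for n and n-1.
*)

theory Submission
  imports Defs
begin

section \<open>The indeterminate and closure properties of integral Laurent polynomials\<close>

lemma q_neq_0 [simp]: "q \<noteq> 0"
  by (simp add: q_def)

lemma q_power_neq_1:
  assumes "0 < n"
  shows "q ^ n \<noteq> 1"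
proof -
  have "to_fract (monom 1 1 ^ n) \<noteq> (to_fract 1 :: int poly fract)"
    using assms unfolding to_fract_eq_iff monom_power
    by (metis degree_1 degree_monom_eq mult_1 not_gr0 one_neq_zero power_one)
  moreover have "to_fract (p ^ n) = to_fract p ^ n" for p :: "int poly"
    by (induction n) simp_all
  ultimately show ?thesis
    by (simp add: q_def)
qed

lemma q_neq_1 [simp]: "q \<noteq> 1"
  using q_power_neq_1[of 1] by simp

lemma int_laurent_poly_monom: "int_laurent_poly (of_int c * q powi i)"
  unfolding int_laurent_poly_def
  by (rule exI[of _ "{i}"], rule exI[of _ "\<lambda>_. c"]) simp

lemma int_laurent_poly_of_int: "int_laurent_poly (of_int c)"
  using int_laurent_poly_monom[of c 0] by simp

lemma int_laurent_poly_0: "int_laurent_poly 0"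
  using int_laurent_poly_of_int[of 0] by simp

lemma int_laurent_poly_1: "int_laurent_poly 1"
  using int_laurent_poly_of_int[of 1] by simp

lemma int_laurent_poly_powi: "int_laurent_poly (q powi i)"
  using int_laurent_poly_monom[of 1 i] by simp

lemma int_laurent_poly_add:
  assumes "int_laurent_poly f" "int_laurent_poly g"
  shows "int_laurent_poly (f + g)"
proof -
  obtain A c where A: "finite A" "f = (\<Sum>i\<in>A. of_int (c i) * q powi i)"
    using assms(1) unfolding int_laurent_poly_def by blast
  obtain B d where B: "finite B" "g = (\<Sum>i\<in>B. of_int (d i) * q powi i)"
    using assms(2) unfolding int_laurent_poly_def by blast
  \<comment> \<open>\<open>c\<close> and \<open>d\<close> are arbitrary off \<open>A\<close> and
    \<open>B\<close>, so they are cut to 0 there before both sums run over the union.\<close>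
  let ?c = "\<lambda>i. if i \<in> A then c i else 0" and ?d = "\<lambda>i. if i \<in> B then d i else 0"
  have "f = (\<Sum>i\<in>A \<union> B. of_int (?c i) * q powi i)"
    unfolding A(2) using A(1) B(1) by (intro sum.mono_neutral_cong_left) auto
  moreover have "g = (\<Sum>i\<in>A \<union> B. of_int (?d i) * q powi i)"
    unfolding B(2) using A(1) B(1) by (intro sum.mono_neutral_cong_left) auto
  ultimately have "f + g = (\<Sum>i\<in>A \<union> B. of_int (?c i + ?d i) * q powi i)"
    by (simp only: of_int_add distrib_right sum.distrib)
  then show ?thesis
    unfolding int_laurent_poly_def using A(1) B(1)
    by (intro exI[of _ "A \<union> B"] exI[of _ "\<lambda>i. ?c i + ?d i"]) simp
qed

lemma int_laurent_poly_sum: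
  "(\<And>i. i \<in> A \<Longrightarrow> int_laurent_poly (f i)) \<Longrightarrow> int_laurent_poly (\<Sum>i\<in>A. f i)"
  by (induction A rule: infinite_finite_induct)
    (auto intro: int_laurent_poly_add int_laurent_poly_0)

lemma int_laurent_poly_mult:
  assumes "int_laurent_poly f" "int_laurent_poly g"
  shows "int_laurent_poly (f * g)"
proof -
  obtain A c where A: "finite A" "f = (\<Sum>i\<in>A. of_int (c i) * q powi i)"
    using assms(1) unfolding int_laurent_poly_def by blast
  obtain B d where B: "finite B" "g = (\<Sum>i\<in>B. of_int (d i) * q powi i)"
    using assms(2) unfolding int_laurent_poly_def by blast
  \<comment> \<open>Like exponents need not be collected: closure under finite sums handles the
    double sum of monomials.\<close>
  have "f * g = (\<Sum>i\<in>A. \<Sum>l\<in>B. of_int (c i * d l) * q powi (i + l))"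
    unfolding A(2) B(2) sum_product
    by (intro sum.cong refl) (simp add: power_int_add mult_ac)
  then show ?thesis
    by (simp only: int_laurent_poly_sum int_laurent_poly_monom)
qed

lemma int_laurent_poly_power: "int_laurent_poly (q ^ n)"
  using int_laurent_poly_powi[of "int n"] by simp

lemma int_laurent_poly_diff:
  assumes "int_laurent_poly f" "int_laurent_poly g"
  shows "int_laurent_poly (f - g)"
  using int_laurent_poly_add[OF assms(1)
      int_laurent_poly_mult[OF int_laurent_poly_of_int[of "-1"] assms(2)]]
  by simp

lemma int_laurent_poly_q_number: "int_laurent_poly (q_number n)"
proof -
  have "q_number n = (\<Sum>i<n. q ^ i)"
    unfolding q_number_def one_diff_power_eq[of q n] by (rule nonzero_mult_div_cancel_left) simp
  then show ?thesis
    by (simp add: int_laurent_poly_sum int_laurent_poly_power)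
qed

lemmas int_laurent_poly_intros =
  int_laurent_poly_0 int_laurent_poly_1 int_laurent_poly_powi int_laurent_poly_power
  int_laurent_poly_add int_laurent_poly_diff int_laurent_poly_mult int_laurent_poly_sum
  int_laurent_poly_q_number

section \<open>q-factorials, q-binomial coefficients and the q-Vandermonde identity\<close>

lemma q_poch_0 [simp]: "q_poch 0 = 1"
  by (simp add: q_poch_def)

lemma q_poch_Suc: "q_poch (Suc n) = q_poch n * (1 - q ^ Suc n)"
  by (simp add: q_poch_def)

lemma q_poch_neq_0 [simp]: "q_poch n \<noteq> 0"
proof -
  have "\<forall>i\<in>{1..n}. 1 - q ^ i \<noteq> 0" by (simp add: q_power_neq_1)
  then show ?thesis
    unfolding q_poch_def by (subst prod_zero_iff) blast+
qed

text \<open>The \<open>q\<close>-binomial coefficients by Pascal's rule, which makes their integrality evident.\<close>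

fun qbin :: "nat \<Rightarrow> nat \<Rightarrow> int poly fract" where
  "qbin n 0 = 1"
| "qbin 0 (Suc k) = 0"
| "qbin (Suc n) (Suc k) = qbin n k + q ^ Suc k * qbin n (Suc k)"

lemma int_laurent_poly_qbin: "int_laurent_poly (qbin n k)"
  by (induction n k rule: qbin.induct)
    (auto intro!: int_laurent_poly_intros simp del: power_Suc)

lemma qbin_eq_0: "n < k \<Longrightarrow> qbin n k = 0"
  by (induction n k rule: qbin.induct) auto

lemma qbin_self: "qbin n n = 1"
  by (induction n) (auto simp: qbin_eq_0)

text \<open>Induction on \<open>k + l\<close>: Pascal's rule matches the splitting 1 - q^(k+l) = (1
  - q^k) + q^k (1 - q^l).\<close>

lemma q_poch_add_eq_qbin: "q_poch (k + l) = q_poch k * q_poch l * qbin (k + l) k"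
proof (induction "k + l" arbitrary: k l)
  case 0
  then show ?case by simp
next
  case (Suc n)
  show ?case
  proof (cases "k = 0 \<or> l = 0")
    case True
    then show ?thesis by (auto simp: qbin_self)
  next
    case False
    then obtain k' l' where kl: "k = Suc k'" "l = Suc l'"
      by (metis not0_implies_Suc)
    have 1: "q_poch n = q_poch k' * q_poch l * qbin n k'"
      using Suc.hyps(1)[of k' l] Suc.hyps(2) kl by simp
    have 2: "q_poch n = q_poch k * q_poch l' * qbin n k"
      using Suc.hyps(1)[of k l'] Suc.hyps(2) kl by simp
    have n: "k + l = Suc n" using Suc.hyps(2) by simp
    have "q_poch k * q_poch l * qbin (Suc n) k
      = (q_poch k' * q_poch l * qbin n k') * (1 - q ^ k)
        + q ^ k * (q_poch k * q_poch l' * qbin n k) * (1 - q ^ l)"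
      unfolding kl q_poch_Suc qbin.simps by (simp add: algebra_simps)
    also have "\<dots> = q_poch n * (1 - q ^ k * q ^ l)"
      unfolding 1[symmetric] 2[symmetric] by (simp add: algebra_simps)
    also have "\<dots> = q_poch (Suc n)"
      unfolding q_poch_Suc using n by (simp add: power_add[symmetric])
    finally show ?thesis unfolding n by simp
  qed
qed

lemma qbin_add_eq: "qbin (k + l) k = q_poch (k + l) / (q_poch k * q_poch l)"
  by (simp add: q_poch_add_eq_qbin)

lemma qbin_eq: "k \<le> n \<Longrightarrow> qbin n k = q_poch n / (q_poch k * q_poch (n - k))"
  using qbin_add_eq[of k "n - k"] by simp

text \<open>Pascal's rule on \<open>qbin (Suc x) i\<close> splits the sum: one part is q^z times the
  sum for \<open>x\<close> and \<open>z\<close>, the other, after an index shift, the sum for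
  \<open>x\<close> and \<open>z - 1\<close>. Truncation in \<open>x - i\<close> is harmless because
  \<open>qbin x i\<close> is 0 for i > x.\<close>

lemma q_Vandermonde:
  "qbin (x + w) z = (\<Sum>i\<le>z. q ^ ((x - i) * (z - i)) * qbin x i * qbin w (z - i))"
proof (induction x arbitrary: z)
  case 0
  have "(\<Sum>i\<le>z. q ^ ((0 - i) * (z - i)) * qbin 0 i * qbin w (z - i))
      = (\<Sum>i\<le>z. if i = 0 then qbin w z else 0)"
    by (intro sum.cong refl) (auto simp: qbin_eq_0)
  then show ?case by simp
next
  case (Suc x)
  show ?case
  proof (cases z)
    case 0
    then show ?thesis by simp
  next
    case (Suc y)
    have 1: "q ^ ((Suc x - i) * (z - i)) * (q ^ i * qbin x i) * qbin w (z - i)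
        = q ^ z * (q ^ ((x - i) * (z - i)) * qbin x i * qbin w (z - i))" if "i \<le> z" for i
    proof (cases "i \<le> x")
      case True
      then have "(Suc x - i) * (z - i) + i = z + (x - i) * (z - i)"
        using that by (simp add: Suc_diff_le)
      then have "q ^ ((Suc x - i) * (z - i)) * q ^ i = q ^ z * q ^ ((x - i) * (z - i))"
        by (metis power_add)
      then show ?thesis by (simp add: mult_ac)
    qed (simp add: qbin_eq_0)
    have pascal: "qbin (Suc x) i = q ^ i * qbin x i + (if i = 0 then 0 else qbin x (i - 1))" for i
      by (cases i) simp_all
    have "(\<Sum>i\<le>z. q ^ ((Suc x - i) * (z - i)) * qbin (Suc x) i * qbin w (z - i))
      = (\<Sum>i\<le>z. q ^ ((Suc x - i) * (z - i)) * (q ^ i * qbin x i) * qbin w (z - i))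
        + (\<Sum>i\<le>z. q ^ ((Suc x - i) * (z - i)) * (if i = 0 then 0 else qbin x (i - 1))
            * qbin w (z - i))"
      unfolding sum.distrib[symmetric] pascal by (intro sum.cong refl) (simp add: algebra_simps)
    also have "(\<Sum>i\<le>z. q ^ ((Suc x - i) * (z - i)) * (q ^ i * qbin x i) * qbin w (z - i))
        = q ^ z * qbin (x + w) z"
      unfolding Suc.IH sum_distrib_left by (intro sum.cong refl) (use 1 in auto)
    also have "(\<Sum>i\<le>z. q ^ ((Suc x - i) * (z - i)) * (if i = 0 then 0 else qbin x (i - 1))
          * qbin w (z - i)) = qbin (x + w) y"
      unfolding Suc.IH Suc by (subst sum.atMost_Suc_shift) simp
    finally show ?thesis unfolding Suc by simp
  qed
qed

text \<open>Swapping \<open>x\<close> and \<open>w\<close> and reversing the summation gives another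
  power of q, the one whose exponent separates in \<open>wt_mult_wt'\<close>.\<close>

lemma q_Vandermonde':
  "qbin (x + w) z = (\<Sum>i\<le>z. q ^ ((w - (z - i)) * i) * qbin x i * qbin w (z - i))"
proof -
  have "qbin (x + w) z = (\<Sum>i\<le>z. q ^ ((w - i) * (z - i)) * qbin w i * qbin x (z - i))"
    using q_Vandermonde[of w x z] by (simp add: add.commute)
  also have "\<dots> = (\<Sum>i\<le>z. q ^ ((w - (z - i)) * (z - (z - i))) * qbin w (z - i)
      * qbin x (z - (z - i)))"
    by (rule sum.reindex_bij_witness[where i = "\<lambda>i. z - i" and j = "\<lambda>i. z - i"]) auto
  finally show ?thesis
    by (simp add: mult_ac)
qed

section \<open>The convolution of two weights\<close>

text \<open>This is w_n(k). The value 0 for k > n agrees with \<open>q_binomial\<close> at a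
  negative lower argument.\<close>

definition wt :: "nat \<Rightarrow> nat \<Rightarrow> int poly fract" where
  "wt n k = (if k \<le> n then 1 / (q_poch (n - k) * q_poch (n + k + 1)) else 0)"

text \<open>The cutoff lets sums over s run up to \<open>x\<close> although only s <= y
  contributes.\<close>

definition inv_poch :: "nat \<Rightarrow> nat \<Rightarrow> int poly fract" where
  "inv_poch n s = (if s \<le> n then 1 / q_poch (n - s) else 0)"

text \<open>Substitute s = i + k. The ranges up to \<open>y\<close> and up to \<open>x\<close> may
  differ, but the surplus terms vanish on either side. The weight \<open>e\<close> is left free to
  serve both forms of q-Vandermonde.\<close>

lemma Vandermonde_sum_shift:
  assumes "k \<le> x" "k \<le> y"
  shows "(\<Sum>i\<le>y - k. e i * qbin (x - k) i * qbin (y + k + 1) (y - k - i))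
    = q_poch (x - k) * q_poch (y + k + 1)
      * (\<Sum>s=k..x. e (s - k) * wt s k * inv_poch x s * inv_poch y s)"
proof -
  have "(\<Sum>i\<le>y - k. e i * qbin (x - k) i * qbin (y + k + 1) (y - k - i))
    = (\<Sum>s=k..y. e (s - k) * qbin (x - k) (s - k) * qbin (y + k + 1) (y - s))"
    using assms
    by (intro sum.reindex_bij_witness[where i = "\<lambda>s. s - k" and j = "\<lambda>i. i + k"])
      (auto intro!: arg_cong2[of _ _ _ _ "(*)"] arg_cong2[of _ _ _ _ qbin])
  also have "\<dots> = (\<Sum>s=k..x. q_poch (x - k) * q_poch (y + k + 1)
      * (e (s - k) * wt s k * inv_poch x s * inv_poch y s))"
  proof (rule sum.mono_neutral_cong)
    fix s assume "s \<in> {k..x} - {k..y}"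
    then show "q_poch (x - k) * q_poch (y + k + 1)
      * (e (s - k) * wt s k * inv_poch x s * inv_poch y s) = 0"
      by (auto simp: inv_poch_def)
  next
    fix s assume "s \<in> {k..y} - {k..x}"
    then have "x - k < s - k" using assms by auto
    then show "e (s - k) * qbin (x - k) (s - k) * qbin (y + k + 1) (y - s) = 0"
      by (simp add: qbin_eq_0)
  next
    fix s assume "s \<in> {k..y} \<inter> {k..x}"
    then have s: "k \<le> s" "s \<le> x" "s \<le> y" by auto
    have "qbin (x - k) (s - k) = q_poch (x - k) / (q_poch (s - k) * q_poch (x - s))"
      using s by (subst qbin_eq) auto
    moreover have "qbin (y + k + 1) (y - s)
        = q_poch (y + k + 1) / (q_poch (y - s) * q_poch (s + k + 1))"
      using s by (subst qbin_eq) (auto simp: add.commute[of s])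
    ultimately show "e (s - k) * qbin (x - k) (s - k) * qbin (y + k + 1) (y - s)
      = q_poch (x - k) * q_poch (y + k + 1)
        * (e (s - k) * wt s k * inv_poch x s * inv_poch y s)"
      using s by (simp add: wt_def inv_poch_def mult_ac)
  qed auto
  finally show ?thesis by (simp only: sum_distrib_left)
qed

text \<open>The top index x + y + 1 is split as (x - k) + (y + k + 1), ready for
  q-Vandermonde.\<close>

lemma wt_mult_wt_eq_qbin:
  assumes "k \<le> x" "k \<le> y"
  shows "q_poch (x + y + 1) * wt x k * wt y k
    = qbin ((x - k) + (y + k + 1)) (y - k) / (q_poch (x - k) * q_poch (y + k + 1))"
proof -
  have "qbin ((x - k) + (y + k + 1)) (y - k)
      = q_poch (x + y + 1) / (q_poch (y - k) * q_poch (x + k + 1))"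
    using assms by (subst qbin_eq) (auto simp: add.commute)
  then show ?thesis
    using assms by (simp add: wt_def)
qed

lemma inv_poch_sum_eq_0:
  "y < k \<Longrightarrow> (\<Sum>s=k..x. c s * inv_poch x s * inv_poch y s * wt s k) = 0"
  by (intro sum.neutral) (auto simp: inv_poch_def)

text \<open>The power of q on the right does not involve \<open>k\<close>, so this form leaves j
  alone.\<close>

lemma wt_mult_wt:
  assumes "k \<le> x"
  shows "q_poch (x + y + 1) * wt x k * wt y k
    = (\<Sum>s=k..x. q ^ ((x - s) * (y - s)) * inv_poch x s * inv_poch y s * wt s k)"
proof (cases "k \<le> y")
  case True
  have "q_poch (x + y + 1) * wt x k * wt y k
    = (\<Sum>s=k..x. q ^ ((x - k - (s - k)) * (y - k - (s - k)))
        * wt s k * inv_poch x s * inv_poch y s)"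
    unfolding wt_mult_wt_eq_qbin[OF assms True] q_Vandermonde[of "x - k" "y + k + 1" "y - k"]
      Vandermonde_sum_shift[OF assms True, of "\<lambda>i. q ^ ((x - k - i) * (y - k - i))"]
    by simp
  also have "\<dots> = (\<Sum>s=k..x. q ^ ((x - s) * (y - s)) * inv_poch x s * inv_poch y s * wt s k)"
    by (intro sum.cong refl) (simp add: mult_ac)
  finally show ?thesis .
next
  case False
  then show ?thesis by (subst inv_poch_sum_eq_0) (auto simp: wt_def)
qed

text \<open>The exponent (s+k+1)(s-k) of the second form is (s^2+s) - (k^2+k) and so separates; the
  factor in \<open>k\<close> lowers j by one.\<close>

lemma wt_mult_wt':
  assumes "k \<le> x"
  shows "q_poch (x + y + 1) * wt x k * wt y k
    = (\<Sum>s=k..x. q powi (int s ^ 2 + int s) * inv_poch x s * inv_poch y s * wt s k)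
      * q powi - (int k ^ 2 + int k)"
proof (cases "k \<le> y")
  case True
  have "q_poch (x + y + 1) * wt x k * wt y k
    = (\<Sum>s=k..x. q ^ ((y + k + 1 - (y - k - (s - k))) * (s - k))
        * wt s k * inv_poch x s * inv_poch y s)"
    unfolding wt_mult_wt_eq_qbin[OF assms True] q_Vandermonde'[of "x - k" "y + k + 1" "y - k"]
      Vandermonde_sum_shift[OF assms True, of "\<lambda>i. q ^ ((y + k + 1 - (y - k - i)) * i)"]
    by simp
  also have "\<dots> = (\<Sum>s=k..x. q powi (int s ^ 2 + int s) * inv_poch x s * inv_poch y s * wt s k
      * q powi - (int k ^ 2 + int k))"
  proof (rule sum.cong[OF refl])
    fix s assume "s \<in> {k..x}"
    then have k: "k \<le> s" by simp
    show "q ^ ((y + k + 1 - (y - k - (s - k))) * (s - k)) * wt s k * inv_poch x s * inv_poch y s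
      = q powi (int s ^ 2 + int s) * inv_poch x s * inv_poch y s * wt s k
        * q powi - (int k ^ 2 + int k)"
    \<comment> \<open>The truncated \<open>y - k - (s - k)\<close> is the true y - s only for s <=
      y; beyond that \<open>inv_poch y s\<close> is 0.\<close>
    proof (cases "s \<le> y")
      case s: True
      have "y + k + 1 - (y - k - (s - k)) = s + k + 1"
        using k s True by simp
      then have "int ((y + k + 1 - (y - k - (s - k))) * (s - k))
          = (int s + int k + 1) * (int s - int k)"
        using k by (simp only: of_nat_mult of_nat_diff of_nat_add of_nat_1)
      also have "\<dots> = (int s ^ 2 + int s) + - (int k ^ 2 + int k)"
        by (simp add: algebra_simps power2_eq_square)
      finally have "int ((y + k + 1 - (y - k - (s - k))) * (s - k))
          = (int s ^ 2 + int s) + - (int k ^ 2 + int k)" .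
      then have "q ^ ((y + k + 1 - (y - k - (s - k))) * (s - k))
          = q powi (int s ^ 2 + int s) * q powi - (int k ^ 2 + int k)"
        by (metis power_int_add power_int_of_nat q_neq_0)
      then show ?thesis by (simp only: mult_ac)
    qed (simp add: inv_poch_def)
  qed
  finally show ?thesis by (simp only: sum_distrib_right)
next
  case False
  then show ?thesis by (subst inv_poch_sum_eq_0) (auto simp: wt_def)
qed

section \<open>Sums over chains\<close>

text \<open>The inverse q-binomial of the prefactor contributes the q-factorials of n_1 - a and n_m
  + a: the second closes the chain here, the first stands in \<open>qsum\<close>.\<close>

fun chain :: "nat \<Rightarrow> nat \<Rightarrow> nat list \<Rightarrow> int poly fract" where
  "chain a x [] = q_poch (x + a)"
| "chain a x (y # ys) = q_poch (x + y + 1) * chain a y ys"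

lemma chain_neq_0: "chain a x ys \<noteq> 0"
  by (induction a x ys rule: chain.induct) auto

text \<open>
  For \<open>x # ys\<close> with entries \<open>n\<^sub>1, \<dots>, n\<^sub>m\<close> and
  \<open>f k = (1 - q) q\<^bsup>j(k\<^sup>2+k)-(2r+1)k\<^esup> [2k+1]\<^bsup>2r+1\<^esup>\<close>
  this is the expression of the theorem.
\<close>

definition qsum :: "nat \<Rightarrow> (nat \<Rightarrow> int poly fract) \<Rightarrow> nat \<Rightarrow> nat list \<Rightarrow> int poly fract" where
  "qsum a f x ys = q_poch (x - a) * chain a x ys
    * (\<Sum>k=a..x. f k * wt x k * (\<Prod>y\<leftarrow>ys. wt y k))"

text \<open>Only the first factor of a chain depends on its head, so for s <= y the quotient
  collapses to a single q-binomial coefficient.\<close>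

lemma int_laurent_poly_chain_ratio:
  assumes "a \<le> s"
  shows "int_laurent_poly (chain a y ys * inv_poch y s / chain a s ys)"
proof (cases "s \<le> y")
  case s: True
  show ?thesis
  proof (cases ys)
    case Nil
    have "qbin (y + a) (s + a) = q_poch (y + a) / (q_poch (s + a) * q_poch (y - s))"
      using s by (subst qbin_eq) auto
    then have "chain a y ys * inv_poch y s / chain a s ys = qbin (y + a) (s + a)"
      using s Nil by (simp add: inv_poch_def)
    then show ?thesis by (simp add: int_laurent_poly_qbin)
  next
    case (Cons z zs)
    have "qbin (y + z + 1) (s + z + 1)
        = q_poch (y + z + 1) / (q_poch (s + z + 1) * q_poch (y - s))"
      using s by (subst qbin_eq) auto
    then have "chain a y ys * inv_poch y s / chain a s ys = qbin (y + z + 1) (s + z + 1)"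
      using s Cons chain_neq_0 by (simp add: inv_poch_def)
    then show ?thesis by (simp only: int_laurent_poly_qbin)
  qed
qed (simp add: inv_poch_def int_laurent_poly_0)

text \<open>The hypothesis fits both forms of the convolution: \<open>c\<close> takes what depends
  on s, \<open>h\<close> the power of q in k, which passes into the summand. Exchanging the sums
  over k and s leaves, for each s, a chain with head s in place of \<open>x\<close> and
  \<open>y\<close>.\<close>

lemma qsum_Cons:
  assumes "\<And>k. k \<le> x \<Longrightarrow> q_poch (x + y + 1) * wt x k * wt y k
      = (\<Sum>s=k..x. c s * inv_poch x s * inv_poch y s * wt s k) * h k"
  shows "qsum a f x (y # ys) = (\<Sum>s=a..x. c s * qbin (x - a) (s - a)
      * (chain a y ys * inv_poch y s / chain a s ys) * qsum a (\<lambda>k. h k * f k) s ys)"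
proof -
  let ?W = "\<lambda>k. \<Prod>y\<leftarrow>ys. wt y k"
  let ?t = "\<lambda>k s. c s * inv_poch x s * inv_poch y s * (h k * f k * wt s k * ?W k)"
  have "qsum a f x (y # ys) = q_poch (x - a) * chain a y ys
      * (\<Sum>k=a..x. f k * (q_poch (x + y + 1) * wt x k * wt y k) * ?W k)"
    unfolding qsum_def by (simp add: sum_distrib_left mult_ac)
  also have "(\<Sum>k=a..x. f k * (q_poch (x + y + 1) * wt x k * wt y k) * ?W k)
      = (\<Sum>k=a..x. \<Sum>s=k..x. ?t k s)"
    using assms by (intro sum.cong refl) (simp add: sum_distrib_left sum_distrib_right mult_ac)
  also have "\<dots> = (\<Sum>s=a..x. \<Sum>k=a..s. ?t k s)"
    unfolding sum.Sigma[OF finite_atLeastAtMost ballI[OF finite_atLeastAtMost]]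
    by (rule sum.reindex_bij_witness[where i = prod.swap and j = prod.swap]) auto
  also have "q_poch (x - a) * chain a y ys * \<dots> = (\<Sum>s=a..x. c s * qbin (x - a) (s - a)
      * (chain a y ys * inv_poch y s / chain a s ys) * qsum a (\<lambda>k. h k * f k) s ys)"
  proof (subst sum_distrib_left, rule sum.cong[OF refl])
    fix s assume "s \<in> {a..x}"
    then have s: "a \<le> s" "s \<le> x" by auto
    have "qbin (x - a) (s - a) = q_poch (x - a) / (q_poch (s - a) * q_poch (x - s))"
      using s by (subst qbin_eq) auto
    \<comment> \<open>The \<open>q_poch (s - a)\<close> appearing here is the leading factor of the
      shorter \<open>qsum\<close>.\<close>
    then have *: "q_poch (x - a) * inv_poch x s = qbin (x - a) (s - a) * q_poch (s - a)"
      using s by (simp add: inv_poch_def)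
    have "q_poch (x - a) * chain a y ys * (\<Sum>k=a..s. ?t k s)
      = chain a y ys * ((q_poch (x - a) * inv_poch x s)
          * (c s * inv_poch y s * (\<Sum>k=a..s. h k * f k * wt s k * ?W k)))"
      by (simp add: sum_distrib_left mult_ac)
    also have "\<dots> = (chain a y ys * inv_poch y s) * (c s * qbin (x - a) (s - a) * q_poch (s - a)
        * (\<Sum>k=a..s. h k * f k * wt s k * ?W k))"
      unfolding * by (simp only: mult_ac)
    also have "chain a y ys * inv_poch y s
        = (chain a y ys * inv_poch y s / chain a s ys) * chain a s ys"
      using chain_neq_0[of a s ys] by simp
    finally show "q_poch (x - a) * chain a y ys * (\<Sum>k=a..s. ?t k s)
      = c s * qbin (x - a) (s - a) * (chain a y ys * inv_poch y s / chain a s ys)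
        * qsum a (\<lambda>k. h k * f k) s ys"
      unfolding qsum_def by (simp only: mult_ac)
  qed
  finally show ?thesis .
qed

lemma int_laurent_poly_qsum_Cons:
  assumes "\<And>k. k \<le> x \<Longrightarrow> q_poch (x + y + 1) * wt x k * wt y k
      = (\<Sum>s=k..x. c s * inv_poch x s * inv_poch y s * wt s k) * h k"
    and "\<And>s. int_laurent_poly (c s)"
    and "\<And>s. int_laurent_poly (qsum a (\<lambda>k. h k * f k) s ys)"
  shows "int_laurent_poly (qsum a f x (y # ys))"
proof -
  have "qsum a f x (y # ys) = (\<Sum>s=a..x. c s * qbin (x - a) (s - a)
      * (chain a y ys * inv_poch y s / chain a s ys) * qsum a (\<lambda>k. h k * f k) s ys)"
    by (rule qsum_Cons) (rule assms(1))
  also have "int_laurent_poly \<dots>"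
    by (intro int_laurent_poly_sum int_laurent_poly_mult int_laurent_poly_qbin
        int_laurent_poly_chain_ratio assms(2,3)) simp
  finally show ?thesis .
qed

text \<open>Each convolution shortens the list by one and lowers j by one unless j = 0. Hence j <= 1
  once the list is empty, and two base cases suffice.\<close>

lemma int_laurent_poly_qsum_list:
  assumes 0: "\<And>s. int_laurent_poly (qsum a f s [])"
    and 1: "\<And>s. int_laurent_poly (qsum a (\<lambda>k. q powi (int k ^ 2 + int k) * f k) s [])"
    and "j \<le> Suc (length ys)"
  shows "int_laurent_poly (qsum a (\<lambda>k. q powi (int j * (int k ^ 2 + int k)) * f k) x ys)"
  using assms(3)
proof (induction ys arbitrary: x j)
  case Nil
  then consider "j = 0" | "j = 1" by fastforce
  then show ?case
    using 0 1 by cases auto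
next
  case (Cons y ys)
  show ?case
  proof (cases j)
    case j: 0
    show ?thesis
      using Cons.IH[of 0] wt_mult_wt[of _ x y] j
      by (intro int_laurent_poly_qsum_Cons[where h = "\<lambda>_. 1"
          and c = "\<lambda>s. q ^ ((x - s) * (y - s))"])
        (auto intro: int_laurent_poly_intros)
  next
    case j: (Suc i)
    have *: "q powi - (int k ^ 2 + int k) * (q powi (int j * (int k ^ 2 + int k)) * f k)
        = q powi (int i * (int k ^ 2 + int k)) * f k" for k
      unfolding j mult.assoc[symmetric]
      by (subst power_int_add[symmetric]) (auto simp: algebra_simps)
    show ?thesis
    proof (rule int_laurent_poly_qsum_Cons[where h = "\<lambda>k. q powi - (int k ^ 2 + int k)"
          and c = "\<lambda>s. q powi (int s ^ 2 + int s)"])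
      show "int_laurent_poly (q powi (int s ^ 2 + int s))" for s
        by (rule int_laurent_poly_powi)
      show "int_laurent_poly (qsum a (\<lambda>k. q powi - (int k ^ 2 + int k)
          * (q powi (int j * (int k ^ 2 + int k)) * f k)) s ys)" for s
        unfolding * using Cons.IH[of i s] Cons.prems j by simp
    qed (rule wt_mult_wt')
  qed
qed

section \<open>Chains with one element\<close>

text \<open>With v(k) = 1 / ((q;q)_(n-k) (q;q)_(n+k)), this product is v(k) and that of
  \<open>wt_mult_right\<close> is v(k+1): the two halves of a telescoping term.\<close>

lemma wt_mult_left:
  assumes "k \<le> n"
  shows "wt n k * (1 - q ^ (n + k + 1)) = 1 / (q_poch (n - k) * q_poch (n + k))"
  using assms q_poch_Suc[of "n + k"] by (simp add: wt_def q_power_neq_1 del: power_Suc)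

lemma wt_mult_right:
  assumes "k < n"
  shows "wt n k * (1 - q ^ (n - k)) = 1 / (q_poch (n - Suc k) * q_poch (n + Suc k))"
  using assms q_poch_Suc[of "n - Suc k"]
  by (simp add: wt_def q_power_neq_1 Suc_diff_Suc del: power_Suc)

text \<open>This is (1 - q) q^(-k) [2k+1], the case r = 0, j = 0; the factor 1 - q comes from 1 /
  [n_1+n_m+1].\<close>

definition odd_wt :: "nat \<Rightarrow> int poly fract" where
  "odd_wt k = q powi - int k * (1 - q ^ (2 * k + 1))"

lemma sum_telescope_Suc_diff:
  fixes v :: "nat \<Rightarrow> 'a::ab_group_add"
  assumes "a \<le> n"
  shows "(\<Sum>k=a..n. v k - v (Suc k)) = v a - v (Suc n)"
  using assms by (induction rule: dec_induct) simp_all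

text \<open>As q^(n-k) (1 - q^(2k+1)) = (1 - q^(n+k+1)) - (1 - q^(n-k)), the sum telescopes to its
  term at \<open>a\<close>, which the q-factorials in front cancel.\<close>

lemma qsum_odd_wt:
  assumes "a \<le> n"
  shows "qsum a odd_wt n [] = q powi - int n"
proof -
  \<comment> \<open>The value 0 beyond \<open>n\<close> ends the telescoping and agrees with 1 -
    q^(n-k) = 0 at k = n.\<close>
  define v where "v k = (if k \<le> n then 1 / (q_poch (n - k) * q_poch (n + k)) else 0)" for k
  have "odd_wt k * wt n k = q powi - int n * (v k - v (Suc k))" if "k \<le> n" for k
  proof -
    have "(1 - q ^ (n + k + 1)) - (1 - q ^ (n - k)) = q ^ (n - k) * (1 - q ^ (2 * k + 1))"
      using that by (simp add: algebra_simps power_add[symmetric] mult_2 add.commute)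
    moreover have "q ^ (n - k) = q powi int n * q powi - int k"
      using that by (simp add: power_int_add[symmetric] flip: power_int_of_nat)
    ultimately have "(1 - q ^ (n + k + 1)) - (1 - q ^ (n - k)) = q powi int n * odd_wt k"
      by (metis odd_wt_def mult.assoc)
    then have *: "odd_wt k = q powi - int n * ((1 - q ^ (n + k + 1)) - (1 - q ^ (n - k)))"
      by (simp add: power_int_minus)
    have "odd_wt k * wt n k
        = q powi - int n * (wt n k * (1 - q ^ (n + k + 1)) - wt n k * (1 - q ^ (n - k)))"
      unfolding * right_diff_distrib[of "wt n k", symmetric] by (simp only: mult_ac)
    also have "\<dots> = q powi - int n * (v k - v (Suc k))"
      unfolding wt_mult_left[OF that] using that wt_mult_right[of k n]
      by (cases "k = n") (auto simp: v_def)
    finally show ?thesis .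
  qed
  then have "(\<Sum>k=a..n. odd_wt k * wt n k) = q powi - int n * (\<Sum>k=a..n. v k - v (Suc k))"
    by (simp add: sum_distrib_left)
  also have "\<dots> = q powi - int n * v a"
    unfolding sum_telescope_Suc_diff[OF assms] by (simp add: v_def)
  finally show ?thesis
    using assms by (simp add: qsum_def v_def)
qed

text \<open>Here 1 - q^(2k+1) = (1 - q^(n+k+1)) - q^(2k+1) (1 - q^(n-k)) telescopes once v carries
  q^(k^2), because k^2 + 2k + 1 = (k+1)^2.\<close>

lemma qsum_odd_wt':
  assumes "a \<le> n"
  shows "qsum a (\<lambda>k. q powi (int k ^ 2 + int k) * odd_wt k) n [] = q powi (int a ^ 2)"
proof -
  define v where
    "v k = (if k \<le> n then q powi (int k ^ 2) / (q_poch (n - k) * q_poch (n + k)) else 0)" for k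
  have "q powi (int k ^ 2 + int k) * odd_wt k * wt n k = v k - v (Suc k)" if "k \<le> n" for k
  proof -
    have "q ^ (2 * k + 1) * q ^ (n - k) = q ^ (n + k + 1)"
      unfolding power_add[symmetric] using that by (simp add: add.commute)
    then have 1: "1 - q ^ (2 * k + 1) = (1 - q ^ (n + k + 1)) - q ^ (2 * k + 1) * (1 - q ^ (n - k))"
      by (simp add: algebra_simps)
    have 2: "q powi (int k ^ 2) * q ^ (2 * k + 1) = q powi (int (Suc k) ^ 2)"
      by (subst power_int_of_nat[symmetric], subst power_int_add[symmetric])
        (auto simp: power2_eq_square algebra_simps)
    have "q powi (int k ^ 2 + int k) * odd_wt k = q powi (int k ^ 2) * (1 - q ^ (2 * k + 1))"
      unfolding odd_wt_def mult.assoc[symmetric] by (subst power_int_add[symmetric]) auto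
    also have "\<dots> = q powi (int k ^ 2) * (1 - q ^ (n + k + 1))
        - q powi (int (Suc k) ^ 2) * (1 - q ^ (n - k))"
      unfolding 1 2[symmetric] by (simp add: algebra_simps)
    finally have 3: "q powi (int k ^ 2 + int k) * odd_wt k = q powi (int k ^ 2) * (1 - q ^ (n + k + 1))
        - q powi (int (Suc k) ^ 2) * (1 - q ^ (n - k))" .
    have "q powi (int k ^ 2 + int k) * odd_wt k * wt n k
        = q powi (int k ^ 2) * (wt n k * (1 - q ^ (n + k + 1)))
          - q powi (int (Suc k) ^ 2) * (wt n k * (1 - q ^ (n - k)))"
      unfolding 3 left_diff_distrib[of _ _ "wt n k"] by (simp only: mult_ac)
    also have "\<dots> = v k - v (Suc k)"
      unfolding wt_mult_left[OF that] using that wt_mult_right[of k n]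
      by (cases "k = n") (auto simp: v_def)
    finally show ?thesis .
  qed
  then have "(\<Sum>k=a..n. q powi (int k ^ 2 + int k) * odd_wt k * wt n k)
      = (\<Sum>k=a..n. v k - v (Suc k))"
    by simp
  also have "\<dots> = v a"
    unfolding sum_telescope_Suc_diff[OF assms] by (simp add: v_def)
  finally show ?thesis
    using assms by (simp add: qsum_def v_def)
qed

section \<open>Higher odd powers of [2k+1] by multiplication with V_k\<close>

definition admissible :: "nat \<Rightarrow> (nat \<Rightarrow> int poly fract) \<Rightarrow> bool" where
  "admissible a f \<longleftrightarrow> (\<forall>n. int_laurent_poly (qsum a f n []))"

lemma qsum_eq_0: "n < a \<Longrightarrow> qsum a f n ys = 0"
  by (simp add: qsum_def)

lemma admissible_odd_wt: "admissible a odd_wt"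
  unfolding admissible_def
  by (metis int_laurent_poly_0 int_laurent_poly_powi linorder_not_less qsum_eq_0 qsum_odd_wt)

lemma admissible_odd_wt': "admissible a (\<lambda>k. q powi (int k ^ 2 + int k) * odd_wt k)"
  unfolding admissible_def
  by (metis (no_types, lifting) int_laurent_poly_0 int_laurent_poly_powi linorder_not_less
      qsum_eq_0 qsum_odd_wt')

lemma admissible_add:
  assumes "admissible a f" "admissible a g"
  shows "admissible a (\<lambda>k. f k + g k)"
proof -
  have "qsum a (\<lambda>k. f k + g k) n [] = qsum a f n [] + qsum a g n []" for n
    by (simp add: qsum_def sum.distrib algebra_simps)
  then show ?thesis
    using assms by (simp add: admissible_def int_laurent_poly_add)
qed

lemma admissible_scale:
  assumes "admissible a f" "int_laurent_poly c"
  shows "admissible a (\<lambda>k. c * f k)"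
proof -
  have "qsum a (\<lambda>k. c * f k) n [] = c * qsum a f n []" for n
    by (simp add: qsum_def sum_distrib_left mult_ac)
  then show ?thesis
    using assms by (simp add: admissible_def int_laurent_poly_mult)
qed

text \<open>This is V_k, a q-analogue of k(k+1).\<close>

definition even_wt :: "nat \<Rightarrow> int poly fract" where
  "even_wt k = q powi - int k * q_number k * q_number (k + 1)"

lemma one_minus_q_power_eq: "1 - q ^ n = (1 - q) * q_number n"
  by (simp add: q_number_def)

lemma odd_wt_eq: "odd_wt k = (1 - q) * (q powi - int k * q_number (2 * k + 1))"
  unfolding odd_wt_def one_minus_q_power_eq by (simp only: mult_ac)

text \<open>The additive form in q^(-k) and q^(k+1) serves both the difference V_n - V_k and the
  square in \<open>odd_square_eq\<close>.\<close>

lemma even_wt_eq: "(1 - q) ^ 2 * even_wt k = q powi - int k + q * q ^ k - 1 - q"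
proof -
  have "(1 - q) ^ 2 * even_wt k = q powi - int k * ((1 - q ^ k) * (1 - q ^ (k + 1)))"
    unfolding one_minus_q_power_eq even_wt_def by (simp add: power2_eq_square mult_ac)
  moreover have "u * ((1 - v) * (1 - q * v)) = u + q * v - 1 - q" if "u * v = 1" for u v
    using that by algebra
  ultimately show ?thesis by (simp add: power_int_minus)
qed

text \<open>A q-analogue of n(n+1) - k(k+1) = (n-k)(n+k+1).\<close>

lemma even_wt_diff:
  assumes "k \<le> n"
  shows "even_wt n - even_wt k
    = q powi - int n * ((1 - q ^ (n - k)) * (1 - q ^ (n + k + 1))) / (1 - q) ^ 2"
proof -
  have *: "q ^ n = q ^ (n - k) * q ^ k"
    using assms by (simp add: power_add[symmetric])
  have "(1 - q) ^ 2 * (even_wt n - even_wt k)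
      = q powi - int n * ((1 - q ^ (n - k)) * (1 - q ^ (n + k + 1)))"
    unfolding right_diff_distrib even_wt_eq
    by (simp add: power_int_minus power_add * field_simps)
  then show ?thesis
    by (simp add: field_simps)
qed

text \<open>The two factors of V_(n+1) - V_k are the top factors of the q-factorials in
  \<open>wt (Suc n) k\<close>.\<close>

lemma wt_pred:
  assumes "k \<le> n"
  shows "wt (Suc n) k * ((1 - q ^ (Suc n - k)) * (1 - q ^ (Suc n + k + 1))) = wt n k"
proof -
  have "wt (Suc n) k * ((1 - q ^ (Suc n - k)) * (1 - q ^ (Suc n + k + 1)))
      = wt (Suc n) k * (1 - q ^ (Suc n + k + 1)) * (1 - q ^ (Suc n - k))"
    by (simp only: mult_ac)
  also have "\<dots> = 1 / (q_poch (Suc n - k) * q_poch (Suc n + k)) * (1 - q ^ (Suc n - k))"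
    by (subst wt_mult_left) (use assms in auto)
  also have "\<dots> = wt n k"
    using assms q_poch_Suc[of "n - k"] by (simp add: wt_def Suc_diff_le q_power_neq_1 del: power_Suc)
  finally show ?thesis .
qed

text \<open>Write V_k = V_(n+1) - (V_(n+1) - V_k); the difference turns the weight for n + 1 into
  that for n. Its denominator (1 - q)^2 is absorbed by the ratio of the q-factorials in front, so
  the coefficients are integral.\<close>

lemma qsum_even_wt:
  "qsum a (\<lambda>k. even_wt k * f k) (Suc n) [] = even_wt (Suc n) * qsum a f (Suc n) []
    - q powi - int (Suc n) * q_number (Suc n - a) * q_number (Suc n + a) * qsum a f n []"
proof (cases "a \<le> n")
  case True
  let ?P = "q_poch (Suc n - a) * q_poch (Suc n + a)"
  have P: "?P = (1 - q) ^ 2 * q_number (Suc n - a) * q_number (Suc n + a)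
      * (q_poch (n - a) * q_poch (n + a))"
    using True q_poch_Suc[of "n - a"] q_poch_Suc[of "n + a"]
    by (simp add: Suc_diff_le one_minus_q_power_eq power2_eq_square del: power_Suc)
  have "even_wt k * f k * wt (Suc n) k = even_wt (Suc n) * (f k * wt (Suc n) k)
      - q powi - int (Suc n) / (1 - q) ^ 2 * (f k * wt n k)" if "k \<le> n" for k
  proof -
    have "even_wt k = even_wt (Suc n) - q powi - int (Suc n)
        * ((1 - q ^ (Suc n - k)) * (1 - q ^ (Suc n + k + 1))) / (1 - q) ^ 2"
      using even_wt_diff[of k "Suc n"] that by simp
    moreover have "x * f k * w = y * (f k * w) - u / c * (f k * (w * d))"
      if "x = y - u * d / c" for x y u d c w
      unfolding that by (simp add: algebra_simps)
    ultimately show ?thesis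
      unfolding wt_pred[OF that, symmetric] by blast
  qed
  then have "(\<Sum>k=a..n. even_wt k * f k * wt (Suc n) k)
      = even_wt (Suc n) * (\<Sum>k=a..n. f k * wt (Suc n) k)
        - q powi - int (Suc n) / (1 - q) ^ 2 * (\<Sum>k=a..n. f k * wt n k)"
    by (simp add: sum_distrib_left sum_subtractf)
  \<comment> \<open>At k = n + 1 the difference V_(n+1) - V_k is 0, so the last sum still stops at
    \<open>n\<close>.\<close>
  then have "(\<Sum>k=a..Suc n. even_wt k * f k * wt (Suc n) k)
      = even_wt (Suc n) * (\<Sum>k=a..Suc n. f k * wt (Suc n) k)
        - q powi - int (Suc n) / (1 - q) ^ 2 * (\<Sum>k=a..n. f k * wt n k)"
    using True by (simp add: algebra_simps)
  then have "qsum a (\<lambda>k. even_wt k * f k) (Suc n) [] = even_wt (Suc n) * qsum a f (Suc n) []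
      - q powi - int (Suc n) / (1 - q) ^ 2 * (?P * (\<Sum>k=a..n. f k * wt n k))"
    unfolding qsum_def by (simp add: right_diff_distrib mult_ac)
  then show ?thesis
    unfolding P qsum_def by simp
next
  case False
  then show ?thesis
    by (cases "a = Suc n") (auto simp: qsum_def)
qed

lemma admissible_even_wt:
  assumes "admissible a f"
  shows "admissible a (\<lambda>k. even_wt k * f k)"
  unfolding admissible_def
proof
  fix n
  have f: "int_laurent_poly (qsum a f m [])" for m
    using assms by (simp add: admissible_def)
  show "int_laurent_poly (qsum a (\<lambda>k. even_wt k * f k) n [])"
  proof (cases n)
    \<comment> \<open>The recursion starts at n = 1; at n = 0 only k = 0 can occur, where V_0 =
      0.\<close>
    case 0
    then show ?thesis
      by (simp add: qsum_def even_wt_def q_number_def int_laurent_poly_0)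
  next
    case (Suc m)
    have "int_laurent_poly (even_wt n)"
      unfolding even_wt_def by (intro int_laurent_poly_intros)
    then show ?thesis
      unfolding Suc qsum_even_wt by (intro int_laurent_poly_intros f) auto
  qed
qed

text \<open>With u = q^(-k), v = q^k and uv = 1, the square of u (1 - q v^2) is (u + qv)^2 - 4q, and
  u + qv = 1 + q + (1-q)^2 V_k. Since (1+q)^2 - 4q = (1-q)^2, a factor (1-q)^2 cancels
  throughout.\<close>

lemma odd_square_eq:
  "(q powi - int k * q_number (2 * k + 1)) ^ 2
    = 1 + 2 * (1 + q) * even_wt k + (1 - q) ^ 2 * (even_wt k * even_wt k)"
proof -
  let ?u = "q powi - int k" and ?v = "q ^ k"
  have uv: "?u * ?v = 1"
    by (simp add: power_int_minus)
  have 1: "(u * (1 - q * (v * v))) ^ 2 = (u + q * v) ^ 2 - 4 * q" if "u * v = 1" for u v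
    using that by algebra
  have 2: "(1 + q + (1 - q) ^ 2 * e) ^ 2 - 4 * q
      = (1 - q) ^ 2 * (1 + 2 * (1 + q) * e + (1 - q) ^ 2 * (e * e))" for e
    by algebra
  have "(1 - q) ^ 2 * (?u * q_number (2 * k + 1)) ^ 2 = (?u * (1 - q ^ (2 * k + 1))) ^ 2"
    unfolding one_minus_q_power_eq by (simp add: power2_eq_square mult_ac)
  also have "\<dots> = (?u * (1 - q * (?v * ?v))) ^ 2"
    by (simp add: mult_2 power_add)
  also have "\<dots> = (1 + q + (1 - q) ^ 2 * even_wt k) ^ 2 - 4 * q"
    unfolding even_wt_eq 1[OF uv] by simp
  finally show ?thesis
    unfolding 2 by simp
qed

lemma admissible_odd_power:
  assumes "admissible a f"
  shows "admissible a (\<lambda>k. ((q powi - int k * q_number (2 * k + 1)) ^ 2) ^ r * f k)"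
proof (induction r)
  case 0
  then show ?case using assms by simp
next
  case (Suc r)
  let ?g = "\<lambda>k. ((q powi - int k * q_number (2 * k + 1)) ^ 2) ^ r * f k"
  have 2: "int_laurent_poly (2 * (1 + q))" "int_laurent_poly ((1 - q) ^ 2)"
    using int_laurent_poly_of_int[of 2] int_laurent_poly_power[of 1]
    by (auto simp: power2_eq_square intro!: int_laurent_poly_intros)
  have "(\<lambda>k. ((q powi - int k * q_number (2 * k + 1)) ^ 2) ^ Suc r * f k)
    = (\<lambda>k. ?g k + 2 * (1 + q) * (even_wt k * ?g k)
        + (1 - q) ^ 2 * (even_wt k * (even_wt k * ?g k)))"
    unfolding power_Suc odd_square_eq by (simp add: algebra_simps)
  then show ?case
    using Suc.IH by (simp only:) (intro admissible_add admissible_scale admissible_even_wt 2)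
qed

section \<open>The cyclic product\<close>

lemma chain_map:
  "chain a (n i) (map n [Suc i..<Suc i + l])
    = (\<Prod>t=i..<i + l. q_poch (n t + n (t + 1) + 1)) * q_poch (n (i + l) + a)"
proof (induction l arbitrary: i)
  case 0
  then show ?case by simp
next
  case (Suc l)
  have "[Suc i..<Suc i + Suc l] = Suc i # [Suc (Suc i)..<Suc (Suc i) + l]"
    by (simp add: upt_rec)
  then show ?case
    using Suc.IH[of "Suc i"] by (simp add: prod.atLeast_Suc_lessThan mult.assoc)
qed

lemma prod_cyclic_shift:
  fixes h :: "nat \<Rightarrow> 'a::comm_monoid_mult"
  assumes "h (Suc m) = h 1"
  shows "(\<Prod>i=1..m. h (Suc i)) = (\<Prod>i=1..m. h i)"
proof (cases m)
  case (Suc l)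
  have "(\<Prod>i=1..Suc l. h i) = h 1 * (\<Prod>i=1..l. h (Suc i))"
    by (simp add: prod.atLeast_Suc_atMost prod.atLeast_Suc_atMost_Suc_shift del: prod.cl_ivl_Suc)
  then show ?thesis
    using assms Suc by (simp add: mult.commute)
qed simp

lemma q_binomial_eq:
  assumes "k \<le> x"
  shows "q_binomial (x + y) (int x - int k) = q_poch (x + y) / (q_poch (x - k) * q_poch (y + k))"
proof -
  have "nat (int x - int k) = x - k" "x + y - (x - k) = y + k"
    using assms by auto
  then show ?thesis
    using assms by (simp add: q_binomial_def)
qed

text \<open>The i-th q-binomial coefficient has n_i - k and n_(i+1) + k + 1 in its denominator; the
  cyclic shift moves the latter to index i, where the two form w_(n_i)(k). If some n_i < k, both
  sides are 0.\<close>

lemma prod_q_binomial: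
  fixes n :: "nat \<Rightarrow> nat"
  assumes "n (m + 1) = n 1"
  shows "(\<Prod>i=1..m. q_binomial (n i + n (i + 1) + 1) (int (n i) - int k))
    = (\<Prod>i=1..m. q_poch (n i + n (i + 1) + 1)) * (\<Prod>i=1..m. wt (n i) k)"
proof (cases "\<forall>i\<in>{1..m}. k \<le> n i")
  case True
  have "(\<Prod>i=1..m. q_binomial (n i + n (i + 1) + 1) (int (n i) - int k))
      = (\<Prod>i=1..m. q_poch (n i + n (i + 1) + 1)
          / (q_poch (n i - k) * q_poch (n (Suc i) + k + 1)))"
    using True q_binomial_eq[of k "n _" "n _ + 1"] by (intro prod.cong refl) (simp add: add_ac)
  also have "\<dots> = (\<Prod>i=1..m. q_poch (n i + n (i + 1) + 1))
      / ((\<Prod>i=1..m. q_poch (n i - k)) * (\<Prod>i=1..m. q_poch (n (Suc i) + k + 1)))"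
    by (simp add: prod_dividef prod.distrib)
  also have "(\<Prod>i=1..m. q_poch (n (Suc i) + k + 1)) = (\<Prod>i=1..m. q_poch (n i + k + 1))"
    using assms by (intro prod_cyclic_shift) simp
  also have "(\<Prod>i=1..m. q_poch (n i + n (i + 1) + 1))
      / ((\<Prod>i=1..m. q_poch (n i - k)) * (\<Prod>i=1..m. q_poch (n i + k + 1)))
      = (\<Prod>i=1..m. q_poch (n i + n (i + 1) + 1)) * (\<Prod>i=1..m. wt (n i) k)"
    using True by (simp add: wt_def prod_dividef prod.distrib)
  finally show ?thesis .
next
  case False
  then obtain i where "i \<in> {1..m}" "n i < k" by (auto simp: not_le)
  then have "(\<Prod>i=1..m. q_binomial (n i + n (i + 1) + 1) (int (n i) - int k)) = 0"
    "(\<Prod>i=1..m. wt (n i) k) = 0"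
    by (auto intro!: prod_zero bexI[of _ i] simp: q_binomial_def wt_def)
  then show ?thesis by (simp only: mult_zero_right)
qed

section \<open>Reduction of the cyclic sum to a chain\<close>

theorem theorem5p3:
  fixes m a j r :: nat and n :: "nat \<Rightarrow> nat"
  assumes "m \<ge> 1"
    and "\<And>i. i \<in> {1..m} \<Longrightarrow> n i \<ge> 1"
    and "n (m + 1) = n 1"
    and "a \<le> n 1"
    and "j \<le> m"
  shows "int_laurent_poly
    (1 / q_number (n 1 + n m + 1) * inverse (q_binomial (n 1 + n m) (int (n 1) - int a)) *
      (\<Sum>k=a..n 1. q powi (int j * (int k ^ 2 + int k) - (2 * int r + 1) * int k)
         * q_number (2 * k + 1) ^ (2 * r + 1)
         * (\<Prod>i=1..m. q_binomial (n i + n (i + 1) + 1) (int (n i) - int k))))"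
proof -
  obtain l where m: "m = Suc l"
    using assms(1) by (cases m) auto
  define ys where "ys = map n [Suc 1..<Suc 1 + l]"
  \<comment> \<open>Of the 2r + 1 equal factors one goes into \<open>odd_wt\<close> together with 1
    - q, the others form r squares.\<close>
  define f where "f k = ((q powi - int k * q_number (2 * k + 1)) ^ 2) ^ r * odd_wt k" for k
  let ?N = "n 1 + n m" and ?e = "\<lambda>k. q powi (int j * (int k ^ 2 + int k))"
  let ?W = "\<lambda>k. wt (n 1) k * (\<Prod>y\<leftarrow>ys. wt y k)"
  define C where "C = (\<Prod>i=1..m. q_poch (n i + n (i + 1) + 1))"
  have "admissible a (\<lambda>k. ((q powi - int k * q_number (2 * k + 1)) ^ 2) ^ r
      * (q powi (int k ^ 2 + int k) * odd_wt k))"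
    by (intro admissible_odd_power admissible_odd_wt')
  then have "admissible a (\<lambda>k. q powi (int k ^ 2 + int k) * f k)"
    unfolding f_def by (simp only: mult.left_commute)
  moreover have "admissible a f"
    unfolding f_def by (intro admissible_odd_power admissible_odd_wt)
  \<comment> \<open>\<open>ys\<close> has m - 1 entries, so the bound required of j is exactly j <=
    m.\<close>
  ultimately have laurent: "int_laurent_poly (qsum a (\<lambda>k. ?e k * f k) (n 1) ys)"
    using assms(5) by (intro int_laurent_poly_qsum_list) (auto simp: admissible_def ys_def m)
  have prefactor: "1 / q_number (?N + 1) * inverse (q_binomial ?N (int (n 1) - int a))
      = (1 - q) * q_poch (n 1 - a) * q_poch (n m + a) / q_poch (?N + 1)"
    unfolding q_binomial_eq[OF assms(4)] using q_poch_Suc[of ?N]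
    by (simp add: q_number_def mult_ac del: power_Suc)
  have summand: "q powi (int j * (int k ^ 2 + int k) - (2 * int r + 1) * int k)
         * q_number (2 * k + 1) ^ (2 * r + 1)
         * (\<Prod>i=1..m. q_binomial (n i + n (i + 1) + 1) (int (n i) - int k))
      = C / (1 - q) * (?e k * f k * ?W k)" for k
  proof -
    have "(\<Prod>i=1..m. wt (n i) k) = wt (n 1) k * (\<Prod>i\<in>{Suc 1..m}. wt (n i) k)"
      using assms(1) by (rule prod.atLeast_Suc_atMost)
    also have "{Suc 1..m} = set [Suc 1..<Suc 1 + l]"
      by (auto simp: m)
    also have "(\<Prod>i\<in>set [Suc 1..<Suc 1 + l]. wt (n i) k) = (\<Prod>y\<leftarrow>ys. wt y k)"
      unfolding ys_def by (subst prod.distinct_set_conv_list) (simp_all add: o_def del: set_upt upt_Suc)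
    finally have 1: "(\<Prod>i=1..m. q_binomial (n i + n (i + 1) + 1) (int (n i) - int k)) = C * ?W k"
      unfolding prod_q_binomial[OF assms(3)] C_def by simp
    have "(2 * int r + 1) * int k = int k * int (2 * r + 1)"
      by simp
    then have "q powi (int j * (int k ^ 2 + int k) - (2 * int r + 1) * int k)
        = ?e k * (q powi - int k) ^ (2 * r + 1)"
      by (simp only: power_int_diff[OF disjI1[OF q_neq_0]] power_int_minus power_int_mult
          power_int_of_nat power_inverse divide_inverse)
    then have "q powi (int j * (int k ^ 2 + int k) - (2 * int r + 1) * int k)
        * q_number (2 * k + 1) ^ (2 * r + 1)
        = ?e k * (q powi - int k * q_number (2 * k + 1)) ^ (2 * r + 1)"
      by (simp only: power_mult_distrib mult.assoc)
    also have "\<dots> = ?e k * (f k / (1 - q))"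
      unfolding f_def odd_wt_eq power_add power_mult power_one_right by (simp add: mult_ac)
    finally show ?thesis
      unfolding 1 by (simp add: mult_ac)
  qed
  \<comment> \<open>\<open>C\<close> and the chain differ only in the last factor,
    \<open>q_poch (n m + n 1 + 1)\<close> against \<open>q_poch (n m + a)\<close>; the prefactor
    exchanges the two.\<close>
  have "C * q_poch (n m + a) = chain a (n 1) ys * q_poch (?N + 1)"
    unfolding ys_def chain_map C_def using assms(3)
    by (simp add: m atLeastLessThanSuc_atLeastAtMost add.commute mult_ac)
  then have C: "C = chain a (n 1) ys * q_poch (?N + 1) / q_poch (n m + a)"
    by (simp add: field_simps)
  have "(1 - q) * q_poch (n 1 - a) * q_poch (n m + a) / q_poch (?N + 1)
      * (C / (1 - q) * (\<Sum>k=a..n 1. ?e k * f k * ?W k))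
      = qsum a (\<lambda>k. ?e k * f k) (n 1) ys"
    unfolding C qsum_def by (simp add: mult.assoc)
  then show ?thesis
    unfolding prefactor summand sum_distrib_left[symmetric] using laurent by (simp only:)
qed

end
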